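(* Let $n\ge1$ and let $\alpha,\beta,\gamma_1,\dots,\gamma_n\in\widehat{\kappa^\times}$. Suppose that $\overline{\alpha}\gamma_1\cdots\gamma_n\neq\varepsilon$ and $\beta\neq\varepsilon$. Then, for all $\lambda_1,\dots,\lambda_n\in\kappa^\times$, $$(-1)^n\frac{\Big(\prod_{i=1}^n g(\overline{\gamma_i})\Big)g(\overline{\alpha}\gamma_1\cdots\gamma_n)}{g^\circ(\overline{\alpha})}\,F_C^{(n)}\left({\alpha;\beta\atop\gamma_1,\dots,\gamma_n};\lambda_1,\dots,\lambda_n\right)$$ $$=\sum_{u_1,\dots,u_n\in\kappa^\times}\overline{\beta}\Big(1-\sum_{i=1}^n\frac{\lambda_i}{u_i}\Big)\Big(\prod_{i=1}^n\overline{\gamma_i}(u_i)\Big)\overline{\alpha}\gamma_1\cdots\gamma_n\Big(1-\sum_{i=1}^nu_i\Big).$$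
   Context: $\kappa$ is a finite field with $q$ elements of characteristic $p$. $\widehat{\kappa^\times}=\mathrm{Hom}(\kappa^\times,\overline{\mathbb{Q}}^\times)$ is the group of multiplicative characters, $\varepsilon$ the trivial character, $\overline{\eta}=\eta^{-1}$; every $\eta\in\widehat{\kappa^\times}$ (including $\varepsilon$) is extended to $\kappa$ by $\eta(0)=0$. A product of characters followed by an argument means the product character evaluated there. $\delta(\eta)=1$ if $\eta=\varepsilon$ and $0$ otherwise. Fix a non-trivial additive character $\psi\in\mathrm{Hom}(\kappa,\overline{\mathbb{Q}}^\times)$. Put $$g(\eta)=-\sum_{x\in\kappa^\times}\psi(x)\eta(x),\quad g^\circ(\eta)=q^{\delta(\eta)}g(\eta),\quad(\alpha)_\nu=\frac{g(\alpha\nu)}{g(\alpha)},\quad(\alpha)_\nu^\circ=\frac{g^\circ(\alpha\nu)}{g^\circ(\alpha)}.$$ For $\lambda_i\in\kappa$, $$F_C^{(n)}\left({\alpha;\beta\atop\gamma_1,\dots,\gamma_n};\lambda_1,\dots,\lambda_n\right)=\frac{1}{(1-q)^n}\sum_{\nu_1,\dots,\nu_n\in\widehat{\kappa^\times}}\frac{(\alpha)_{\nu_1\cdots\nu_n}(\beta)_{\nu_1\cdots\nu_n}}{(\gamma_1)^\circ_{\nu_1}\cdots(\gamma_n)^\circ_{\nu_n}(\varepsilon)^\circ_{\nu_1}\cdots(\varepsilon)^\circ_{\nu_n}}\nu_1(\lambda_1)\cdots\nu_n(\lambda_n).$$ *)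

theory Defs
  imports "HOL-Algebra.Algebraic_Closure_Type" "HOL-Library.Cardinality"
begin

type_synonym qbar = "rat alg_closure"

text \<open>
  A finite field \<open>\<kappa>\<close> is a type \<open>'k :: finite_field\<close>, with \<open>q = CARD('k)\<close>.  A multiplicative
  character, that is, a homomorphism from \<open>\<kappa>\<^sup>\<times>\<close> to the multiplicative group of \<open>qbar\<close>, is represented
  by its extension by zero to a function on all of \<open>\<kappa>\<close>.  This applies to the trivial character, too:
  it takes the value 0 at 0.
\<close>

definition mult_chars :: "('k :: field \<Rightarrow> qbar) set" where
  "mult_chars = {\<chi>. \<chi> 0 = 0 \<and> (\<forall>x. x \<noteq> 0 \<longrightarrow> \<chi> x \<noteq> 0) \<and>
     (\<forall>x y. x \<noteq> 0 \<longrightarrow> y \<noteq> 0 \<longrightarrow> \<chi> (x * y) = \<chi> x * \<chi> y)}"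

definition trivial_char :: "'k :: field \<Rightarrow> qbar" (\<open>\<epsilon>\<close>) where
  "\<epsilon> = (\<lambda>x. if x = 0 then 0 else 1)"

definition char_mult :: "('k :: field \<Rightarrow> qbar) \<Rightarrow> ('k \<Rightarrow> qbar) \<Rightarrow> 'k \<Rightarrow> qbar" (infixl \<open>\<star>\<close> 70) where
  "\<chi> \<star> \<eta> = (\<lambda>x. \<chi> x * \<eta> x)"

text \<open>The case distinction makes the empty product the trivial character.\<close>

definition char_prod :: "'i set \<Rightarrow> ('i \<Rightarrow> 'k :: field \<Rightarrow> qbar) \<Rightarrow> 'k \<Rightarrow> qbar" where
  "char_prod I \<chi> = (\<lambda>x. if x = 0 then 0 else \<Prod>i\<in>I. \<chi> i x)"

definition char_inv :: "('k :: field \<Rightarrow> qbar) \<Rightarrow> 'k \<Rightarrow> qbar" where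
  "char_inv \<chi> = (\<lambda>x. inverse (\<chi> x))"

definition add_chars :: "('k :: field \<Rightarrow> qbar) set" where
  "add_chars = {\<psi>. (\<forall>x. \<psi> x \<noteq> 0) \<and> (\<forall>x y. \<psi> (x + y) = \<psi> x * \<psi> y)}"

definition char_delta :: "('k :: field \<Rightarrow> qbar) \<Rightarrow> nat" where
  "char_delta \<eta> = (if \<eta> = \<epsilon> then 1 else 0)"

definition gauss :: "('k :: finite_field \<Rightarrow> qbar) \<Rightarrow> ('k \<Rightarrow> qbar) \<Rightarrow> qbar" where
  "gauss \<psi> \<eta> = - (\<Sum>x\<in>UNIV - {0}. \<psi> x * \<eta> x)"

definition gauss_circ :: "('k :: finite_field \<Rightarrow> qbar) \<Rightarrow> ('k \<Rightarrow> qbar) \<Rightarrow> qbar" where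
  "gauss_circ \<psi> \<eta> = of_nat CARD('k) ^ char_delta \<eta> * gauss \<psi> \<eta>"

definition poch :: "('k :: finite_field \<Rightarrow> qbar) \<Rightarrow> ('k \<Rightarrow> qbar) \<Rightarrow> ('k \<Rightarrow> qbar) \<Rightarrow> qbar" where
  "poch \<psi> \<alpha> \<nu> = gauss \<psi> (\<alpha> \<star> \<nu>) / gauss \<psi> \<alpha>"

definition poch_circ :: "('k :: finite_field \<Rightarrow> qbar) \<Rightarrow> ('k \<Rightarrow> qbar) \<Rightarrow> ('k \<Rightarrow> qbar) \<Rightarrow> qbar" where
  "poch_circ \<psi> \<alpha> \<nu> = gauss_circ \<psi> (\<alpha> \<star> \<nu>) / gauss_circ \<psi> \<alpha>"

text \<open>
  The parameters \<open>\<gamma>\<close> and the arguments \<open>l\<close> (\<open>\<lambda>\<close> is reserved) are functions on \<open>nat\<close> of which only the values at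
  \<open>1, \<dots>, n\<close> are used.
\<close>

definition lauricella_FC ::
  "('k :: finite_field \<Rightarrow> qbar) \<Rightarrow> nat \<Rightarrow> ('k \<Rightarrow> qbar) \<Rightarrow> ('k \<Rightarrow> qbar) \<Rightarrow>
   (nat \<Rightarrow> 'k \<Rightarrow> qbar) \<Rightarrow> (nat \<Rightarrow> 'k) \<Rightarrow> qbar" where
  "lauricella_FC \<psi> n \<alpha> \<beta> \<gamma> l =
     1 / (1 - of_nat CARD('k)) ^ n *
     (\<Sum>\<nu>\<in>{1..n} \<rightarrow>\<^sub>E mult_chars.
        poch \<psi> \<alpha> (char_prod {1..n} \<nu>) * poch \<psi> \<beta> (char_prod {1..n} \<nu>) /
        ((\<Prod>i=1..n. poch_circ \<psi> (\<gamma> i) (\<nu> i)) * (\<Prod>i=1..n. poch_circ \<psi> \<epsilon> (\<nu> i))) *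
        (\<Prod>i=1..n. \<nu> i (l i)))"

text \<open>There are only finitely many characters, so the sum above is a genuine finite sum.\<close>

lemma finite_mult_chars: "finite (mult_chars :: ('k :: finite_field \<Rightarrow> qbar) set)"
proof -
  define N where "N = CARD('k)"
  define R where "R = {z :: qbar. poly (monom 1 N - monom 1 1) z = 0}"
  have "card {0 :: 'k, 1} \<le> N" unfolding N_def by (rule card_mono) auto
  then have "N > 1" by simp
  then have "coeff (monom 1 N - monom 1 1 :: qbar poly) N = 1" by simp
  then have "monom 1 N - monom 1 1 \<noteq> (0 :: qbar poly)" by (metis coeff_0 zero_neq_one)
  then have "finite R" unfolding R_def by (rule poly_roots_finite)
  have "mult_chars \<subseteq> (UNIV \<rightarrow>\<^sub>E R :: ('k \<Rightarrow> qbar) set)"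
  proof
    fix \<chi> :: "'k \<Rightarrow> qbar" assume "\<chi> \<in> mult_chars"
    then have mult: "\<chi> (x * y) = \<chi> x * \<chi> y" for x y
      unfolding mult_chars_def by (cases "x = 0"; cases "y = 0") auto
    have pow: "\<chi> (x ^ Suc m) = \<chi> x ^ Suc m" for x m
      by (induction m) (auto simp: mult)
    have "\<chi> x \<in> R" for x
    proof -
      have "\<chi> (x ^ N) = \<chi> x ^ N" using pow[of x "N - 1"] \<open>N > 1\<close> by simp
      then show ?thesis
        by (simp add: R_def N_def poly_monom finite_field_power_card_eq_same)
    qed
    then show "\<chi> \<in> UNIV \<rightarrow>\<^sub>E R" by auto
  qed
  then show ?thesis using \<open>finite R\<close> by (meson finite_PiE finite finite_subset)
qed

end

theory Submission
  imports Defs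
begin

text \<open>
  The sum over the \<open>u\<^sub>i\<close> is a finite-field Euler integral, and the idea is to turn every
  multiplicative character of a compound argument into additive characters, which split sums of
  arguments into products.  Put \<open>\<chi> = \<alpha>\<^sup>-\<^sup>1\<gamma>\<^sub>1\<cdots>\<gamma>\<^sub>n\<close>.  The Fourier transform of a non-trivial
  character is its inverse times a Gauss sum, up to sign (\<open>twisted_gauss_sum_nontrivial\<close>).  Applied to \<open>\<beta>\<^sup>-\<^sup>1\<close> and to \<open>\<chi>\<close>,
  which are non-trivial by hypothesis, this introduces two variables \<open>x\<close> and \<open>y\<close>, after which the
  sum over the \<open>u\<^sub>i\<close> factors into the one-variable sums
  \<open>\<Sum>\<^sub>u \<gamma>\<^sub>i\<^sup>-\<^sup>1(u) \<psi>(- x\<lambda>\<^sub>i/u - yu)\<close>, which are Kloosterman sums twisted by a character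
  (\<open>integral_times_gauss\<close>).

  Mellin inversion over the group of multiplicative characters writes such a Kloosterman sum as a
  character sum whose coefficients are products of two Gauss sums (\<open>twisted_kloosterman_sum\<close>).  When
  the product of these is multiplied out, \<open>x\<close> and \<open>y\<close> occur only through multiplicative characters
  and \<open>\<psi>\<close>, so the sums over them are the Gauss sums of \<open>\<beta>\<nu>\<^sub>1\<cdots>\<nu>\<^sub>n\<close> and \<open>\<alpha>\<nu>\<^sub>1\<cdots>\<nu>\<^sub>n\<close>
  (\<open>integral_eq_character_sum\<close>).

  The reflection formula \<open>g(\<eta>\<^sup>-\<^sup>1) g\<degree>(\<eta>) = \<eta>(-1) q\<close> (\<open>gauss_reflection\<close>) moves the Gauss sums in
  the denominators of \<open>F\<^sub>C\<close> into the numerators and gives the same character sum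
  (\<open>lauricella_FC_eq_character_sum\<close>).  The same formula identifies the remaining constant factors.

  Mellin inversion needs the orthogonality relation \<open>\<Sum>\<^sub>\<nu> \<nu>(x) = 0\<close> for \<open>x \<noteq> 1\<close>, that is, enough
  characters to separate \<open>x\<close> from 1.  They come from a generator of the cyclic group \<open>\<kappa>\<^sup>\<times>\<close> and from
  roots of unity in the algebraically closed field of values (\<open>mult_char_separates\<close>).
\<close>

section \<open>The group of multiplicative characters\<close>

lemma mult_char_0: "\<chi> \<in> mult_chars \<Longrightarrow> \<chi> 0 = 0"
  and mult_char_nonzero: "\<chi> \<in> mult_chars \<Longrightarrow> x \<noteq> 0 \<Longrightarrow> \<chi> x \<noteq> 0"
  by (auto simp: mult_chars_def)

lemma mult_char_mult: "\<chi> \<in> mult_chars \<Longrightarrow> \<chi> (x * y) = \<chi> x * \<chi> y"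
  by (cases "x = 0"; cases "y = 0") (auto simp: mult_chars_def)

lemma mult_char_1:
  assumes "\<chi> \<in> mult_chars" shows "\<chi> 1 = 1"
proof -
  have "\<chi> 1 * \<chi> 1 = \<chi> 1 * 1" using mult_char_mult[OF assms, of 1 1] by simp
  moreover have "\<chi> 1 \<noteq> 0" using assms by (simp add: mult_char_nonzero)
  ultimately show ?thesis by (metis mult_left_cancel)
qed

lemma mult_char_inverse:
  assumes "\<chi> \<in> mult_chars" shows "\<chi> (inverse x) = inverse (\<chi> x)"
proof (cases "x = 0")
  case False
  then have "\<chi> x * \<chi> (inverse x) = 1"
    using assms mult_char_mult[OF assms, of x "inverse x"] by (simp add: mult_char_1)
  then show ?thesis by (simp add: inverse_unique)
qed (use assms in \<open>simp add: mult_char_0\<close>)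

lemma mult_char_minus_1_square:
  assumes "\<chi> \<in> mult_chars" shows "\<chi> (- 1) * \<chi> (- 1) = 1"
  using mult_char_mult[OF assms, of "- 1" "- 1"] assms by (simp add: mult_char_1)

lemma trivial_char_in_mult_chars [simp]: "\<epsilon> \<in> mult_chars"
  by (auto simp: mult_chars_def trivial_char_def)

lemma char_mult_in_mult_chars [simp]:
  "\<chi> \<in> mult_chars \<Longrightarrow> \<eta> \<in> mult_chars \<Longrightarrow> \<chi> \<star> \<eta> \<in> mult_chars"
  by (auto simp: mult_chars_def char_mult_def)

lemma char_inv_in_mult_chars [simp]: "\<chi> \<in> mult_chars \<Longrightarrow> char_inv \<chi> \<in> mult_chars"
  by (auto simp: mult_chars_def char_inv_def)

lemma char_prod_in_mult_chars [simp]: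
  assumes "finite I" "\<And>i. i \<in> I \<Longrightarrow> \<chi> i \<in> mult_chars"
  shows "char_prod I \<chi> \<in> mult_chars"
  using assms by (auto simp: mult_chars_def char_prod_def prod.distrib)

lemma char_inv_char_inv [simp]: "char_inv (char_inv \<chi>) = \<chi>"
  by (simp add: char_inv_def)

lemma char_inv_trivial [simp]: "char_inv \<epsilon> = \<epsilon>"
  by (auto simp: char_inv_def trivial_char_def)

lemma char_inv_eq_trivial_iff [simp]: "char_inv \<chi> = \<epsilon> \<longleftrightarrow> \<chi> = \<epsilon>"
  by (metis char_inv_char_inv char_inv_trivial)

lemma trivial_char_mult [simp]: "\<chi> \<in> mult_chars \<Longrightarrow> \<epsilon> \<star> \<chi> = \<chi>"
  by (auto simp: char_mult_def trivial_char_def mult_char_0)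

lemma char_mult_inv_cancel:
  assumes "\<chi> \<in> mult_chars" "\<eta> \<in> mult_chars" shows "\<chi> \<star> \<eta> \<star> char_inv \<eta> = \<chi>"
proof
  fix x show "(\<chi> \<star> \<eta> \<star> char_inv \<eta>) x = \<chi> x"
    using assms by (cases "x = 0")
      (auto simp: char_mult_def char_inv_def mult_char_0 mult_char_nonzero)
qed

lemma sum_nonzero_mult:
  fixes y :: "'k :: finite_field"
  assumes "y \<noteq> 0"
  shows "(\<Sum>x\<in>UNIV - {0}. f (x * y)) = (\<Sum>x\<in>UNIV - {0}. f x)"
  by (rule sum.reindex_bij_witness[where i = "\<lambda>x. x / y" and j = "\<lambda>x. x * y"])
    (use assms in auto)

lemma sum_nontrivial_char:
  fixes \<chi> :: "'k :: finite_field \<Rightarrow> qbar"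
  assumes "\<chi> \<in> mult_chars" "\<chi> \<noteq> \<epsilon>"
  shows "(\<Sum>x\<in>UNIV - {0}. \<chi> x) = 0"
proof -
  obtain y where y: "\<chi> y \<noteq> \<epsilon> y" using assms(2) by auto
  then have "y \<noteq> 0" "\<chi> y \<noteq> 1"
    using assms(1) by (auto simp: trivial_char_def mult_char_0 split: if_splits)
  have "(\<Sum>x\<in>UNIV - {0}. \<chi> x) * \<chi> y = (\<Sum>x\<in>UNIV - {0}. \<chi> (x * y))"
    using assms(1) by (simp add: sum_distrib_right mult_char_mult)
  also have "\<dots> = (\<Sum>x\<in>UNIV - {0}. \<chi> x)"
    by (rule sum_nonzero_mult) fact
  finally show ?thesis using \<open>\<chi> y \<noteq> 1\<close> by simp
qed

section \<open>Characters separate points\<close>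

lemma power_mod_order:
  fixes z :: "'a :: monoid_mult"
  assumes "z ^ N = 1" shows "z ^ i = z ^ (i mod N)"
proof -
  have "z ^ i = z ^ (N * (i div N) + i mod N)" by (simp only: mult_div_mod_eq)
  also have "\<dots> = z ^ (i mod N)" by (simp only: power_add power_mult assms power_one mult_1_left)
  finally show ?thesis .
qed

text \<open>
  The powers below \<open>q - 1\<close> of a generator of \<open>\<kappa>\<^sup>\<times>\<close> exhaust a set of size \<open>q - 1\<close>, so they are
  distinct.  The bijection serves as a discrete logarithm.
\<close>

lemma finite_field_generator:
  obtains h :: "'k :: finite_field"
  where "bij_betw (\<lambda>i. h ^ i) {..<CARD('k) - 1} (UNIV - {0})" "h ^ (CARD('k) - 1) = 1"
proof -
  define R where "R = (ring_of_type_algebra :: 'k ring)"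
  interpret R: field R unfolding R_def by (rule field_from_type_algebra)
  have pow: "x [^]\<^bsub>R\<^esub> i = x ^ i" for x :: 'k and i :: nat
    by (induction i) (auto simp: R_def ring_of_type_algebra_def)
  have carrier: "carrier (Multiplicative_Group.mult_of R) = UNIV - {0}"
    by (auto simp: R_def ring_of_type_algebra_def)
  have "\<exists>a\<in>carrier (Multiplicative_Group.mult_of R). carrier (Multiplicative_Group.mult_of R) = {a [^]\<^bsub>R\<^esub> i | i::nat. i \<in> UNIV}"
    by (rule R.finite_field_mult_group_has_gen) auto
  then obtain h :: 'k where "h \<in> UNIV - {0}" and "UNIV - {0} = {h ^ i | i::nat. i \<in> UNIV}"
    unfolding carrier pow by blast
  then have "h \<noteq> 0" and gen: "UNIV - {0} = range (\<lambda>i::nat. h ^ i)" by auto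
  define N where "N = CARD('k) - 1"
  have card: "card (UNIV - {0 :: 'k}) = N" by (simp add: N_def card_Diff_subset)
  have "1 \<in> UNIV - {0 :: 'k}" by simp
  then have "N > 0" using card by (metis card_gt_0_iff empty_iff finite)
  have "h * h ^ N = h"
    using finite_field_power_card_eq_same[of h] \<open>N > 0\<close> 
    unfolding N_def by (metis One_nat_def Suc_pred card_Diff_singleton finite_UNIV_card_ge_0 finite power_Suc)
  then have hN: "h ^ N = 1" using \<open>h \<noteq> 0\<close> by simp
  have "h ^ i = h ^ (i mod N)" for i
    by (rule power_mod_order) (rule hN)
  then have "range (\<lambda>i. h ^ i) \<subseteq> (\<lambda>i. h ^ i) ` {..<N}"
    using \<open>N > 0\<close> by (metis image_eqI image_subsetI lessThan_iff mod_less_divisor)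
  then have surj: "(\<lambda>i. h ^ i) ` {..<N} = UNIV - {0}" using gen by auto
  have "bij_betw (\<lambda>i. h ^ i) {..<N} (UNIV - {0})"
    unfolding bij_betw_def using surj card by (auto intro: eq_card_imp_inj_on)
  with hN show ?thesis using that unfolding N_def by blast
qed

text \<open>
  With \<open>c = gcd N k\<close> and \<open>d = N / c > 1\<close>, a \<open>c\<close>-th root of a non-trivial \<open>d\<close>-th root of unity \<open>\<eta>\<close>
  works: its \<open>k\<close>-th power is \<open>\<eta> ^ (k / c)\<close>, and \<open>k / c\<close> is prime to \<open>d\<close>.
\<close>

lemma root_of_unity_power_neq_1:
  assumes "N > 0" "\<not> N dvd k"
  obtains \<zeta> :: "'a :: {alg_closed_field, field_char_0}" where "\<zeta> ^ N = 1" "\<zeta> ^ k \<noteq> 1"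
proof -
  define c where "c = gcd N k"
  define d where "d = N div c"
  define m where "m = k div c"
  have "c > 0" using assms(1) by (simp add: c_def)
  have N: "N = c * d" and k: "k = c * m" by (auto simp: c_def d_def m_def)
  have "coprime d m" unfolding d_def m_def c_def using assms(1) by (intro div_gcd_coprime) auto
  have "d > 1"
  proof (rule ccontr)
    assume "\<not> d > 1"
    then have "d = 1" using assms(1) N by (cases d) auto
    then show False using N k assms(2) by simp
  qed
  \<comment> \<open>A root of \<open>1 + X + \<dots> + X\<^sup>d\<^sup>-\<^sup>1\<close> differs from 1, since \<open>d \<noteq> 0\<close> in characteristic 0.\<close>
  obtain \<eta> :: 'a where "(\<Sum>i\<le>d - 1. 1 * \<eta> ^ i) = 0"
    using alg_closed[of "d - 1" "\<lambda>_. 1 :: 'a"] \<open>d > 1\<close> by auto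
  then have \<eta>: "(\<Sum>i<d. \<eta> ^ i) = 0"
    using \<open>d > 1\<close> by (simp add: lessThan_Suc_atMost[symmetric])
  then have \<eta>d: "\<eta> ^ d = 1" using power_diff_1_eq[of \<eta> d] by simp
  have "\<eta> \<noteq> 1" using \<eta> \<open>d > 1\<close> by auto
  obtain \<zeta> where \<zeta>: "\<zeta> ^ c = \<eta>" using nth_root_exists \<open>c > 0\<close> by blast
  have "m \<noteq> 0" using k assms(2) by (metis dvd_0_right mult_0_right)
  have "\<eta> ^ m \<noteq> 1"
  proof
    assume "\<eta> ^ m = 1"
    obtain a b where "m * a = d * b + 1"
      using bezout_nat[OF \<open>m \<noteq> 0\<close>, of d] \<open>coprime d m\<close> by (auto simp: coprime_commute)
    then have "(\<eta> ^ m) ^ a = (\<eta> ^ d) ^ b * \<eta>"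
      by (simp flip: power_mult add: power_add)
    then show False using \<open>\<eta> ^ m = 1\<close> \<eta>d \<open>\<eta> \<noteq> 1\<close> by simp
  qed
  then show ?thesis using that[of \<zeta>] \<eta>d \<zeta> by (simp add: N k power_mult)
qed

text \<open>
  A character of \<open>\<kappa>\<^sup>\<times>\<close> may send a generator \<open>h\<close> to any root of unity \<open>\<zeta>\<close> of order dividing
  \<open>q - 1\<close>.  If \<open>x = h ^ k \<noteq> 1\<close>, then \<open>q - 1\<close> does not divide \<open>k\<close>, and \<open>\<zeta>\<close> can be chosen with
  \<open>\<zeta> ^ k \<noteq> 1\<close>.
\<close>

lemma mult_char_separates:
  fixes x :: "'k :: finite_field"
  assumes "x \<noteq> 0" "x \<noteq> 1"
  obtains \<chi> where "\<chi> \<in> mult_chars" "\<chi> x \<noteq> 1"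
proof -
  define N where "N = CARD('k) - 1"
  obtain h :: 'k where bij: "bij_betw (\<lambda>i. h ^ i) {..<N} (UNIV - {0})" and hN: "h ^ N = 1"
    using finite_field_generator unfolding N_def by blast
  define ind where "ind = inv_into {..<N} (\<lambda>i. h ^ i)"
  have ind: "ind y < N" "h ^ ind y = y" if "y \<noteq> 0" for y
    using that bij inv_into_into[of y "\<lambda>i. h ^ i" "{..<N}"]
      f_inv_into_f[of y "\<lambda>i. h ^ i" "{..<N}"]
    by (auto simp: ind_def bij_betw_def)
  have "N > 0" using ind(1)[of 1] by simp
  have ind_pow: "ind (h ^ i) = i mod N" for i
    using power_mod_order[OF hN, of i] bij \<open>N > 0\<close> 
    by (simp add: ind_def bij_betw_def inv_into_f_f)
  have "\<not> N dvd ind x"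
    using ind[OF assms(1)] assms(2) by (metis dvd_imp_le not_less power_0 gr0I)
  then obtain \<zeta> :: qbar where \<zeta>: "\<zeta> ^ N = 1" "\<zeta> ^ ind x \<noteq> 1"
    using root_of_unity_power_neq_1 \<open>N > 0\<close> by blast
  define \<chi> where "\<chi> y = (if y = 0 then 0 else \<zeta> ^ ind y)" for y
  have "\<zeta> \<noteq> 0" using \<zeta>(1) \<open>N > 0\<close> by (auto simp: power_0_left)
  have "ind (y * z) = (ind y + ind z) mod N" if "y \<noteq> 0" "z \<noteq> 0" for y z
    using ind_pow[of "ind y + ind z"] ind(2) that by (simp add: power_add)
  then have "\<zeta> ^ ind (y * z) = \<zeta> ^ ind y * \<zeta> ^ ind z" if "y \<noteq> 0" "z \<noteq> 0" for y z
    using that power_mod_order[OF \<zeta>(1), of "ind y + ind z"] by (simp add: power_add)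
  then have "\<chi> \<in> mult_chars" using \<open>\<zeta> \<noteq> 0\<close> by (simp add: mult_chars_def \<chi>_def)
  with that[of \<chi>] show ?thesis using \<zeta>(2) assms(1) by (simp add: \<chi>_def)
qed

lemma sum_mult_chars_mult:
  fixes \<mu> :: "'k :: finite_field \<Rightarrow> qbar"
  assumes "\<mu> \<in> mult_chars"
  shows "(\<Sum>\<nu>\<in>mult_chars. F (\<nu> \<star> \<mu>)) = (\<Sum>\<nu>\<in>mult_chars. F \<nu>)"
proof -
  have "\<nu> \<star> char_inv \<mu> \<star> \<mu> = \<nu>" if "\<nu> \<in> mult_chars" for \<nu>
    using char_mult_inv_cancel[of \<nu> "char_inv \<mu>"] assms that by simp
  then show ?thesis
    using assms by (intro sum.reindex_bij_witness
        [where i = "\<lambda>\<nu>. \<nu> \<star> char_inv \<mu>" and j = "\<lambda>\<nu>. \<nu> \<star> \<mu>"])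
      (auto simp: char_mult_inv_cancel)
qed

text \<open>
  For \<open>x \<noteq> 0\<close>, multiplication by a character \<open>\<mu>\<close> with \<open>\<mu> x \<noteq> 1\<close> permutes the summands and at the
  same time multiplies the sum by \<open>\<mu> x\<close>.
\<close>

lemma sum_mult_chars_eq_0:
  fixes x :: "'k :: finite_field"
  assumes "x \<noteq> 1"
  shows "(\<Sum>\<nu>\<in>mult_chars. \<nu> x) = 0"
proof (cases "x = 0")
  case False
  then obtain \<mu> where \<mu>: "\<mu> \<in> mult_chars" "\<mu> x \<noteq> 1" using assms by (rule mult_char_separates)
  have "(\<Sum>\<nu>\<in>mult_chars. \<nu> x) * \<mu> x = (\<Sum>\<nu>\<in>mult_chars. (\<nu> \<star> \<mu>) x)"
    by (simp add: sum_distrib_right char_mult_def)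
  also have "\<dots> = (\<Sum>\<nu>\<in>mult_chars. \<nu> x)" by (rule sum_mult_chars_mult) fact
  finally show ?thesis using \<mu>(2) by simp
qed (simp add: sum.neutral mult_char_0)

lemma sum_trivial_char:
  "(\<Sum>x\<in>UNIV - {0 :: 'k}. \<epsilon> x) = (of_nat CARD('k :: finite_field) - 1 :: qbar)"
proof -
  have "(\<Sum>x\<in>UNIV - {0 :: 'k}. \<epsilon> x) = (\<Sum>x\<in>UNIV - {0 :: 'k}. 1 :: qbar)"
    by (intro sum.cong) (auto simp: trivial_char_def)
  also have "\<dots> = of_nat CARD('k) - 1"
    by (simp add: card_Diff_subset of_nat_diff Suc_leI)
  finally show ?thesis .
qed

text \<open>
  Summing \<open>\<nu>(x)\<close> over all \<open>\<nu>\<close> and all \<open>x \<noteq> 0\<close> counts the characters if one sums over \<open>\<nu>\<close> first, as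
  only \<open>x = 1\<close> contributes, and gives \<open>q - 1\<close> if one sums over \<open>x\<close> first, as only \<open>\<nu> = \<epsilon>\<close>
  contributes.
\<close>

lemma card_mult_chars:
  "of_nat (card (mult_chars :: ('k \<Rightarrow> qbar) set)) = (of_nat CARD('k :: finite_field) - 1 :: qbar)"
proof -
  have "of_nat (card (mult_chars :: ('k \<Rightarrow> qbar) set)) = (\<Sum>\<nu>\<in>mult_chars. \<nu> (1 :: 'k))"
    by (simp add: mult_char_1)
  also have "\<dots> = (\<Sum>x\<in>UNIV - {0}. \<Sum>\<nu>\<in>mult_chars. \<nu> (x :: 'k))"
    by (subst sum.remove[of _ 1]) (auto intro!: sum.neutral sum_mult_chars_eq_0)
  also have "\<dots> = (\<Sum>\<nu>\<in>mult_chars. \<Sum>x\<in>UNIV - {0}. \<nu> (x :: 'k))" by (rule sum.swap)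
  also have "\<dots> = (\<Sum>x\<in>UNIV - {0 :: 'k}. \<epsilon> x)"
  proof -
    have "(\<Sum>\<nu>\<in>mult_chars - {\<epsilon>}. \<Sum>x\<in>UNIV - {0}. \<nu> (x :: 'k)) = 0"
      by (rule sum.neutral) (simp add: sum_nontrivial_char)
    then show ?thesis by (subst sum.remove[of _ \<epsilon>]) (auto simp: finite_mult_chars)
  qed
  finally show ?thesis by (simp add: sum_trivial_char)
qed

lemma mellin_inversion:
  fixes f :: "'k :: finite_field \<Rightarrow> qbar"
  assumes "z \<noteq> 0"
  shows "(\<Sum>\<nu>\<in>mult_chars. (\<Sum>w\<in>UNIV - {0}. f w * char_inv \<nu> w) * \<nu> z) =
    (of_nat CARD('k) - 1) * f z"
proof -
  have "(\<Sum>\<nu>\<in>mult_chars. (\<Sum>w\<in>UNIV - {0}. f w * char_inv \<nu> w) * \<nu> z) =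
      (\<Sum>\<nu>\<in>mult_chars. \<Sum>w\<in>UNIV - {0}. f w * \<nu> (z / w))"
    by (intro sum.cong)
      (auto simp: sum_distrib_right char_inv_def mult_char_mult mult_char_inverse divide_inverse
        intro!: sum.cong)
  also have "\<dots> = (\<Sum>w\<in>UNIV - {0}. f w * (\<Sum>\<nu>\<in>mult_chars. \<nu> (z / w)))"
    by (subst sum.swap) (simp add: sum_distrib_left)
  also have "\<dots> = f z * (\<Sum>\<nu>\<in>mult_chars. \<nu> (z / z))"
    using assms by (subst sum.remove[of _ z]) (auto intro!: sum.neutral simp: sum_mult_chars_eq_0)
  also have "\<dots> = (of_nat CARD('k) - 1) * f z" using assms
    by (simp add: card_mult_chars mult_char_1)
  finally show ?thesis .
qed

section \<open>Gauss sums\<close>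

lemma add_char_add: "\<psi> \<in> add_chars \<Longrightarrow> \<psi> (x + y) = \<psi> x * \<psi> y"
  by (simp add: add_chars_def)

lemma add_char_0:
  assumes "\<psi> \<in> add_chars" shows "\<psi> 0 = 1"
proof -
  have "\<psi> 0 * \<psi> 0 = \<psi> 0 * 1" using add_char_add[OF assms, of 0 0] by simp
  moreover have "\<psi> 0 \<noteq> 0" using assms by (simp add: add_chars_def)
  ultimately show ?thesis by (metis mult_left_cancel)
qed

lemma add_char_sum:
  assumes "\<psi> \<in> add_chars" "finite I"
  shows "\<psi> (\<Sum>i\<in>I. f i) = (\<Prod>i\<in>I. \<psi> (f i))"
  using assms(2) by (induction I) (simp_all add: add_char_0[OF assms(1)] add_char_add[OF assms(1)])

lemma sum_add_char:
  fixes \<psi> :: "'k :: finite_field \<Rightarrow> qbar"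
  assumes "\<psi> \<in> add_chars" "\<psi> \<noteq> (\<lambda>_. 1)"
  shows "(\<Sum>y\<in>UNIV. \<psi> (y * c)) = (if c = 0 then of_nat CARD('k) else 0)"
proof (cases "c = 0")
  case False
  obtain a where a: "\<psi> a \<noteq> 1" using assms(2) by auto
  have "(\<Sum>y\<in>UNIV. \<psi> (y * c)) = (\<Sum>y\<in>UNIV. \<psi> ((y + a / c) * c))"
    by (rule sum.reindex_bij_witness[where i = "\<lambda>y. y + a / c" and j = "\<lambda>y. y - a / c"]) auto
  also have "\<dots> = (\<Sum>y\<in>UNIV. \<psi> (y * c)) * \<psi> a"
    using False by (simp add: sum_distrib_right distrib_right add_char_add[OF assms(1)])
  finally show ?thesis using a False by simp
qed (simp add: add_char_0 assms)

lemma twisted_gauss_sum: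
  fixes \<psi> :: "'k :: finite_field \<Rightarrow> qbar"
  assumes "\<chi> \<in> mult_chars" "t \<noteq> 0"
  shows "(\<Sum>x\<in>UNIV - {0}. \<chi> x * \<psi> (x * t)) = - (char_inv \<chi> t * gauss \<psi> \<chi>)"
proof -
  have "(\<Sum>x\<in>UNIV - {0}. \<chi> x * \<psi> (x * t)) =
      (\<Sum>x\<in>UNIV - {0}. char_inv \<chi> t * (\<chi> (x * t) * \<psi> (x * t)))"
    using assms
    by (intro sum.cong refl) (simp add: mult_char_mult char_inv_def mult_char_nonzero field_simps)
  also have "\<dots> = (\<Sum>x\<in>UNIV - {0}. char_inv \<chi> t * (\<chi> x * \<psi> x))"
    by (rule sum_nonzero_mult) fact
  finally show ?thesis by (simp add: gauss_def sum_distrib_left mult_ac)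
qed

text \<open>At \<open>t = 0\<close> both sides vanish, the left one because \<open>\<chi>\<close> is non-trivial.\<close>

lemma twisted_gauss_sum_nontrivial:
  fixes \<psi> :: "'k :: finite_field \<Rightarrow> qbar"
  assumes "\<psi> \<in> add_chars" "\<chi> \<in> mult_chars" "\<chi> \<noteq> \<epsilon>"
  shows "(\<Sum>x\<in>UNIV - {0}. \<chi> x * \<psi> (x * t)) = - (char_inv \<chi> t * gauss \<psi> \<chi>)"
proof (cases "t = 0")
  case True
  then show ?thesis using assms
    by (simp add: add_char_0 sum_nontrivial_char char_inv_def mult_char_0)
qed (use assms twisted_gauss_sum in blast)

lemma gauss_trivial:
  fixes \<psi> :: "'k :: finite_field \<Rightarrow> qbar"
  assumes "\<psi> \<in> add_chars" "\<psi> \<noteq> (\<lambda>_. 1)"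
  shows "gauss \<psi> \<epsilon> = 1"
proof -
  have "(\<Sum>x\<in>UNIV. \<psi> x) = 0" using sum_add_char[OF assms, of 1] by simp
  then have "1 + (\<Sum>x\<in>UNIV - {0}. \<psi> x) = 0"
    using assms by (subst (asm) sum.remove[of _ 0]) (auto simp: add_char_0)
  moreover have "(\<Sum>x\<in>UNIV - {0}. \<psi> x * \<epsilon> x) = (\<Sum>x\<in>UNIV - {0}. \<psi> x)"
    by (rule sum.cong) (auto simp: trivial_char_def)
  ultimately show ?thesis by (simp add: gauss_def neg_eq_iff_add_eq_0 add.commute)
qed

text \<open>
  For \<open>\<eta> \<noteq> \<epsilon>\<close>, writing \<open>\<eta>\<^sup>-\<^sup>1(y) g(\<eta>)\<close> as a Fourier transform turns \<open>g(\<eta>\<^sup>-\<^sup>1) g(\<eta>)\<close> into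
  \<open>\<Sum>\<^sub>x \<eta>(x) \<Sum>\<^sub>y \<psi>(y(x + 1))\<close>, where only \<open>x = -1\<close> contributes.  For \<open>\<eta> = \<epsilon>\<close>, where \<open>g(\<epsilon>) = 1\<close>,
  the factor \<open>q\<close> comes from \<open>g\<degree>\<close>.
\<close>

lemma gauss_reflection:
  fixes \<psi> :: "'k :: finite_field \<Rightarrow> qbar"
  assumes \<psi>: "\<psi> \<in> add_chars" "\<psi> \<noteq> (\<lambda>_. 1)" and \<eta>: "\<eta> \<in> mult_chars"
  shows "gauss \<psi> (char_inv \<eta>) * gauss_circ \<psi> \<eta> = \<eta> (- 1) * of_nat CARD('k)"
proof (cases "\<eta> = \<epsilon>")
  case True
  moreover have "\<epsilon> (- 1 :: 'k) = 1" by (simp add: trivial_char_def)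
  ultimately show ?thesis by (simp add: gauss_circ_def char_delta_def gauss_trivial[OF \<psi>])
next
  case False
  have "gauss \<psi> (char_inv \<eta>) * gauss \<psi> \<eta> =
      (\<Sum>y\<in>UNIV - {0}. \<psi> y * - (char_inv \<eta> y * gauss \<psi> \<eta>))"
    by (simp add: gauss_def[of \<psi> "char_inv \<eta>"] sum_distrib_right sum_negf mult.assoc)
  also have "\<dots> = (\<Sum>y\<in>UNIV. \<psi> y * - (char_inv \<eta> y * gauss \<psi> \<eta>))"
    using \<eta> by (intro sum.mono_neutral_left) (auto simp: char_inv_def mult_char_0)
  also have "\<dots> = (\<Sum>y\<in>UNIV. \<Sum>x\<in>UNIV - {0}. \<eta> x * \<psi> (y * (x + 1)))"
    unfolding twisted_gauss_sum_nontrivial[OF \<psi>(1) \<eta> False, symmetric]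
    by (intro sum.cong) (auto simp: sum_distrib_left distrib_left add_char_add[OF \<psi>(1)] mult_ac)
  also have "\<dots> = (\<Sum>x\<in>UNIV - {0}. \<eta> x * (if x + 1 = 0 then of_nat CARD('k) else 0))"
    by (subst sum.swap) (simp only: sum_add_char[OF \<psi>] flip: sum_distrib_left)
  also have "\<dots> = \<eta> (- 1) * of_nat CARD('k)"
    by (subst sum.remove[of _ "- 1"]) (auto intro!: sum.neutral simp: eq_neg_iff_add_eq_0)
  finally show ?thesis using False by (simp add: gauss_circ_def char_delta_def)
qed

lemma gauss_nonzero:
  fixes \<psi> :: "'k :: finite_field \<Rightarrow> qbar"
  assumes "\<psi> \<in> add_chars" "\<psi> \<noteq> (\<lambda>_. 1)" "\<eta> \<in> mult_chars"
  shows "gauss \<psi> \<eta> \<noteq> 0"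
proof
  assume "gauss \<psi> \<eta> = 0"
  then have "\<eta> (- 1) * of_nat CARD('k) = 0"
    using gauss_reflection[OF assms] by (simp add: gauss_circ_def)
  then show False using assms(3) by (simp add: mult_char_nonzero)
qed

lemma gauss_circ_nonzero:
  fixes \<psi> :: "'k :: finite_field \<Rightarrow> qbar"
  assumes "\<psi> \<in> add_chars" "\<psi> \<noteq> (\<lambda>_. 1)" "\<eta> \<in> mult_chars"
  shows "gauss_circ \<psi> \<eta> \<noteq> 0"
  using gauss_nonzero[OF assms] by (simp add: gauss_circ_def)

text \<open>
  Reflection for \<open>\<gamma>\<close>, \<open>\<nu>\<close> and \<open>\<gamma>\<nu>\<close>: the powers of \<open>q\<close> cancel because \<open>g\<degree>(\<epsilon>) = q\<close>, and the signs
  cancel because \<open>\<nu>(-1)\<^sup>2 = 1\<close>.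
\<close>

lemma gauss_div_poch_circ:
  fixes \<psi> :: "'k :: finite_field \<Rightarrow> qbar"
  assumes \<psi>: "\<psi> \<in> add_chars" "\<psi> \<noteq> (\<lambda>_. 1)" and \<gamma>: "\<gamma> \<in> mult_chars" and \<nu>: "\<nu> \<in> mult_chars"
  shows "gauss \<psi> (char_inv \<gamma>) / (poch_circ \<psi> \<gamma> \<nu> * poch_circ \<psi> \<epsilon> \<nu>) =
    gauss \<psi> (char_inv \<nu>) * gauss \<psi> (char_inv (\<gamma> \<star> \<nu>))"
proof -
  let ?q = "of_nat CARD('k) :: qbar"
  have nz: "gauss_circ \<psi> \<gamma> \<noteq> 0" "gauss_circ \<psi> \<nu> \<noteq> 0" "gauss_circ \<psi> (\<gamma> \<star> \<nu>) \<noteq> 0" "?q \<noteq> 0"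
    using assms by (simp_all add: gauss_circ_nonzero)
  have \<epsilon>: "gauss_circ \<psi> \<epsilon> = ?q"
    by (simp add: gauss_circ_def char_delta_def gauss_trivial[OF \<psi>])
  have mult_at_minus_1: "(\<gamma> \<star> \<nu>) (- 1) = \<gamma> (- 1) * \<nu> (- 1)" by (simp add: char_mult_def)
  have "gauss \<psi> (char_inv \<nu>) * gauss \<psi> (char_inv (\<gamma> \<star> \<nu>)) *
      (gauss_circ \<psi> (\<gamma> \<star> \<nu>) * gauss_circ \<psi> \<nu>) =
      (gauss \<psi> (char_inv \<nu>) * gauss_circ \<psi> \<nu>) *
      (gauss \<psi> (char_inv (\<gamma> \<star> \<nu>)) * gauss_circ \<psi> (\<gamma> \<star> \<nu>))" by (simp only: mult_ac)
  also have "\<dots> = \<gamma> (- 1) * ?q * ?q * (\<nu> (- 1) * \<nu> (- 1))"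
    unfolding gauss_reflection[OF \<psi> \<nu>] gauss_reflection[OF \<psi> char_mult_in_mult_chars[OF \<gamma> \<nu>]]
    by (simp only: mult_at_minus_1 mult_ac)
  also have "\<dots> = gauss \<psi> (char_inv \<gamma>) * gauss_circ \<psi> \<gamma> * ?q"
    by (simp only: gauss_reflection[OF \<psi> \<gamma>] mult_char_minus_1_square[OF \<nu>] mult_1_right)
  finally show ?thesis
    using nz \<nu> by (simp add: poch_circ_def \<epsilon> divide_simps)
qed

section \<open>Kloosterman sums twisted by a character\<close>

text \<open>
  Expanding \<open>\<psi>(a/u)\<close> by Mellin inversion leaves, for each character \<open>\<nu>\<close>, the Gauss sum of
  \<open>(\<gamma>\<nu>)\<^sup>-\<^sup>1\<close> twisted by \<open>b\<close>.
\<close>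

lemma twisted_kloosterman_sum:
  fixes \<psi> :: "'k :: finite_field \<Rightarrow> qbar"
  assumes \<psi>: "\<psi> \<in> add_chars" and \<gamma>: "\<gamma> \<in> mult_chars" and nz: "a \<noteq> 0" "b \<noteq> 0"
  shows "(\<Sum>u\<in>UNIV - {0}. char_inv \<gamma> u * \<psi> (a / u + b * u)) * (of_nat CARD('k) - 1) =
    \<gamma> b * (\<Sum>\<nu>\<in>mult_chars.
      gauss \<psi> (char_inv \<nu>) * gauss \<psi> (char_inv (\<gamma> \<star> \<nu>)) * \<nu> (a * b))"
proof -
  have mellin: "\<psi> z * (of_nat CARD('k) - 1) =
      (\<Sum>\<nu>\<in>mult_chars. - gauss \<psi> (char_inv \<nu>) * \<nu> z)" if "z \<noteq> 0" for z
    using mellin_inversion[OF that, of \<psi>] by (simp add: gauss_def mult.commute)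
  have "(\<Sum>u\<in>UNIV - {0}. char_inv \<gamma> u * \<psi> (a / u + b * u)) * (of_nat CARD('k) - 1) =
      (\<Sum>u\<in>UNIV - {0}. char_inv \<gamma> u * \<psi> (b * u) * (\<psi> (a / u) * (of_nat CARD('k) - 1)))"
    unfolding sum_distrib_right by (simp only: add_char_add[OF \<psi>] mult_ac)
  also have "\<dots> = (\<Sum>u\<in>UNIV - {0}. \<Sum>\<nu>\<in>mult_chars.
      - gauss \<psi> (char_inv \<nu>) * \<nu> a * (char_inv (\<gamma> \<star> \<nu>) u * \<psi> (u * b)))"
  proof (intro sum.cong refl)
    fix u :: 'k assume "u \<in> UNIV - {0}"
    then have "a / u \<noteq> 0" using nz(1) by simp
    show "char_inv \<gamma> u * \<psi> (b * u) * (\<psi> (a / u) * (of_nat CARD('k) - 1)) =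
        (\<Sum>\<nu>\<in>mult_chars. - gauss \<psi> (char_inv \<nu>) * \<nu> a * (char_inv (\<gamma> \<star> \<nu>) u * \<psi> (u * b)))"
      unfolding mellin[OF \<open>a / u \<noteq> 0\<close>] sum_distrib_left
      by (intro sum.cong refl)
        (simp add: divide_inverse mult_char_mult mult_char_inverse char_inv_def char_mult_def mult_ac)
  qed
  also have "\<dots> = (\<Sum>\<nu>\<in>mult_chars. - gauss \<psi> (char_inv \<nu>) * \<nu> a *
      (\<Sum>u\<in>UNIV - {0}. char_inv (\<gamma> \<star> \<nu>) u * \<psi> (u * b)))"
    by (subst sum.swap) (simp only: sum_distrib_left)
  also have "\<dots> = (\<Sum>\<nu>\<in>mult_chars. - gauss \<psi> (char_inv \<nu>) * \<nu> a *
      - ((\<gamma> \<star> \<nu>) b * gauss \<psi> (char_inv (\<gamma> \<star> \<nu>))))"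
    using \<gamma> nz(2) by (intro sum.cong refl) (simp add: twisted_gauss_sum)
  also have "\<dots> = \<gamma> b * (\<Sum>\<nu>\<in>mult_chars.
      gauss \<psi> (char_inv \<nu>) * gauss \<psi> (char_inv (\<gamma> \<star> \<nu>)) * \<nu> (a * b))"
    unfolding sum_distrib_left
    by (intro sum.cong refl) (simp add: char_mult_def mult_char_mult mult_ac)
  finally show ?thesis .
qed

section \<open>The Euler integral as a character sum\<close>

text \<open>
  With \<open>a = - x\<lambda>\<^sub>i\<close> and \<open>b = - y\<close> the argument \<open>ab\<close> of \<open>\<nu>\<^sub>i\<close> is \<open>xy\<lambda>\<^sub>i\<close>, so that the dependence on \<open>x\<close>
  and \<open>y\<close> separates and is governed by the product of the \<open>\<nu>\<^sub>i\<close> alone.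
\<close>

lemma prod_kloosterman:
  fixes \<psi> :: "'k :: finite_field \<Rightarrow> qbar"
  assumes \<psi>: "\<psi> \<in> add_chars" and I: "finite I"
    and \<gamma>: "\<And>i. i \<in> I \<Longrightarrow> \<gamma> i \<in> mult_chars" and l: "\<And>i. i \<in> I \<Longrightarrow> l i \<noteq> 0"
    and nz: "x \<noteq> 0" "y \<noteq> 0"
  shows "(\<Prod>i\<in>I. \<Sum>u\<in>UNIV - {0}. char_inv (\<gamma> i) u * \<psi> (- (x * l i) / u + - y * u)) *
      (of_nat CARD('k) - 1) ^ card I =
    char_prod I \<gamma> (- y) * (\<Sum>\<nu>\<in>I \<rightarrow>\<^sub>E mult_chars.
      (\<Prod>i\<in>I. gauss \<psi> (char_inv (\<nu> i)) * gauss \<psi> (char_inv (\<gamma> i \<star> \<nu> i)) * \<nu> i (l i)) *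
      (char_prod I \<nu> x * char_prod I \<nu> y))"
proof -
  have "(\<Prod>i\<in>I. \<Sum>u\<in>UNIV - {0}. char_inv (\<gamma> i) u * \<psi> (- (x * l i) / u + - y * u)) *
      (of_nat CARD('k) - 1) ^ card I =
    (\<Prod>i\<in>I. (\<Sum>u\<in>UNIV - {0}. char_inv (\<gamma> i) u * \<psi> (- (x * l i) / u + - y * u)) *
      (of_nat CARD('k) - 1))"
    by (simp only: prod.distrib prod_constant)
  also have "\<dots> = (\<Prod>i\<in>I. \<gamma> i (- y) * (\<Sum>\<nu>\<in>mult_chars. gauss \<psi> (char_inv \<nu>) *
      gauss \<psi> (char_inv (\<gamma> i \<star> \<nu>)) * \<nu> (l i) * (\<nu> x * \<nu> y)))"
  proof (intro prod.cong refl)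
    fix i assume "i \<in> I"
    then show "(\<Sum>u\<in>UNIV - {0}. char_inv (\<gamma> i) u * \<psi> (- (x * l i) / u + - y * u)) *
        (of_nat CARD('k) - 1) = \<gamma> i (- y) * (\<Sum>\<nu>\<in>mult_chars. gauss \<psi> (char_inv \<nu>) *
        gauss \<psi> (char_inv (\<gamma> i \<star> \<nu>)) * \<nu> (l i) * (\<nu> x * \<nu> y))"
      using nz \<gamma> l
      by (subst twisted_kloosterman_sum[OF \<psi>])
        (auto simp: mult_char_mult mult_ac intro!: sum.cong)
  qed
  also have "\<dots> = char_prod I \<gamma> (- y) * (\<Prod>i\<in>I. \<Sum>\<nu>\<in>mult_chars. gauss \<psi> (char_inv \<nu>) *
      gauss \<psi> (char_inv (\<gamma> i \<star> \<nu>)) * \<nu> (l i) * (\<nu> x * \<nu> y))"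
    using nz by (simp add: prod.distrib char_prod_def)
  also have "\<dots> = char_prod I \<gamma> (- y) * (\<Sum>\<nu>\<in>I \<rightarrow>\<^sub>E mult_chars. \<Prod>i\<in>I. gauss \<psi> (char_inv (\<nu> i)) *
      gauss \<psi> (char_inv (\<gamma> i \<star> \<nu> i)) * \<nu> i (l i) * (\<nu> i x * \<nu> i y))"
    by (subst prod_sum_PiE) (auto simp: I finite_mult_chars)
  finally show ?thesis using nz by (simp add: prod.distrib char_prod_def)
qed

text \<open>
  Both characters of compound arguments are replaced by their Fourier transforms.  As \<open>\<psi>\<close> is
  additive, the summand then becomes a product over \<open>i\<close> of functions of \<open>u\<^sub>i\<close>.
\<close>

lemma integral_times_gauss:
  fixes \<psi> :: "'k :: finite_field \<Rightarrow> qbar"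
  assumes \<psi>: "\<psi> \<in> add_chars" and I: "finite I"
    and \<beta>: "\<beta> \<in> mult_chars" "\<beta> \<noteq> \<epsilon>" and \<chi>: "\<chi> \<in> mult_chars" "\<chi> \<noteq> \<epsilon>"
  shows "gauss \<psi> \<beta> * gauss \<psi> (char_inv \<chi>) * (\<Sum>u\<in>I \<rightarrow>\<^sub>E (UNIV - {0}).
      char_inv \<beta> (1 - (\<Sum>i\<in>I. l i / u i)) * (\<Prod>i\<in>I. char_inv (\<gamma> i) (u i)) *
      \<chi> (1 - (\<Sum>i\<in>I. u i))) =
    (\<Sum>x\<in>UNIV - {0}. \<Sum>y\<in>UNIV - {0}. \<beta> x * char_inv \<chi> y * \<psi> x * \<psi> y *
      (\<Prod>i\<in>I. \<Sum>u\<in>UNIV - {0}. char_inv (\<gamma> i) u * \<psi> (- (x * l i) / u + - y * u)))"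
proof -
  let ?U = "I \<rightarrow>\<^sub>E (UNIV - {0 :: 'k})"
  have \<psi>_split: "\<psi> (x * (1 - (\<Sum>i\<in>I. l i / u i))) * \<psi> (y * (1 - (\<Sum>i\<in>I. u i))) =
      \<psi> x * \<psi> y * (\<Prod>i\<in>I. \<psi> (- (x * l i) / u i + - y * u i))" for x y u
  proof -
    have "x * (1 - (\<Sum>i\<in>I. l i / u i)) + y * (1 - (\<Sum>i\<in>I. u i)) =
        x + y + (\<Sum>i\<in>I. - (x * l i) / u i + - y * u i)"
      by (simp add: algebra_simps sum_distrib_left sum.distrib sum_negf sum_subtractf)
    then show ?thesis
      by (simp only: add_char_add[OF \<psi>, symmetric] add_char_sum[OF \<psi> I, symmetric])
  qed
  have "gauss \<psi> \<beta> * gauss \<psi> (char_inv \<chi>) * (\<Sum>u\<in>?U.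
      char_inv \<beta> (1 - (\<Sum>i\<in>I. l i / u i)) * (\<Prod>i\<in>I. char_inv (\<gamma> i) (u i)) *
      \<chi> (1 - (\<Sum>i\<in>I. u i))) =
    (\<Sum>u\<in>?U. (\<Prod>i\<in>I. char_inv (\<gamma> i) (u i)) *
      (- (char_inv \<beta> (1 - (\<Sum>i\<in>I. l i / u i)) * gauss \<psi> \<beta>) *
       - (char_inv (char_inv \<chi>) (1 - (\<Sum>i\<in>I. u i)) * gauss \<psi> (char_inv \<chi>))))"
    by (simp add: sum_distrib_left mult_ac)
  also have "\<dots> = (\<Sum>u\<in>?U. (\<Prod>i\<in>I. char_inv (\<gamma> i) (u i)) *
      ((\<Sum>x\<in>UNIV - {0}. \<beta> x * \<psi> (x * (1 - (\<Sum>i\<in>I. l i / u i)))) *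
       (\<Sum>y\<in>UNIV - {0}. char_inv \<chi> y * \<psi> (y * (1 - (\<Sum>i\<in>I. u i))))))"
    using \<beta> \<chi> by (simp only: twisted_gauss_sum_nontrivial[OF \<psi>] char_inv_in_mult_chars
        char_inv_eq_trivial_iff not_False_eq_True)
  also have "\<dots> = (\<Sum>u\<in>?U. \<Sum>x\<in>UNIV - {0}. \<Sum>y\<in>UNIV - {0}.
      \<beta> x * char_inv \<chi> y * (\<Prod>i\<in>I. char_inv (\<gamma> i) (u i)) *
      (\<psi> (x * (1 - (\<Sum>i\<in>I. l i / u i))) * \<psi> (y * (1 - (\<Sum>i\<in>I. u i)))))"
    unfolding sum_product unfolding sum_distrib_left by (simp only: mult_ac)
  also have "\<dots> = (\<Sum>u\<in>?U. \<Sum>x\<in>UNIV - {0}. \<Sum>y\<in>UNIV - {0}. \<beta> x * char_inv \<chi> y * \<psi> x * \<psi> y *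
      (\<Prod>i\<in>I. char_inv (\<gamma> i) (u i) * \<psi> (- (x * l i) / u i + - y * u i)))"
    unfolding \<psi>_split by (simp only: prod.distrib mult_ac)
  also have "\<dots> = (\<Sum>x\<in>UNIV - {0}. \<Sum>y\<in>UNIV - {0}. \<Sum>u\<in>?U. \<beta> x * char_inv \<chi> y * \<psi> x * \<psi> y *
      (\<Prod>i\<in>I. char_inv (\<gamma> i) (u i) * \<psi> (- (x * l i) / u i + - y * u i)))"
    by (subst sum.swap) (intro sum.cong refl sum.swap)
  also have "\<dots> = (\<Sum>x\<in>UNIV - {0}. \<Sum>y\<in>UNIV - {0}. \<beta> x * char_inv \<chi> y * \<psi> x * \<psi> y *
      (\<Prod>i\<in>I. \<Sum>u\<in>UNIV - {0}. char_inv (\<gamma> i) u * \<psi> (- (x * l i) / u + - y * u)))"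
    by (subst prod_sum_PiE) (auto simp: I sum_distrib_left)
  finally show ?thesis .
qed


text \<open>
  The Kloosterman sums contribute \<open>\<gamma>\<^sub>1\<cdots>\<gamma>\<^sub>n(- y)\<close>, which cancels the \<open>\<gamma>\<^sub>i\<close> in \<open>\<chi>\<^sup>-\<^sup>1(y)\<close> up to a sign.
  This leaves \<open>\<alpha>(y)\<close>, hence the Gauss sum of \<open>\<alpha>\<nu>\<^sub>1\<cdots>\<nu>\<^sub>n\<close>.
\<close>

lemma integral_eq_character_sum:
  fixes \<psi> :: "'k :: finite_field \<Rightarrow> qbar"
  assumes \<psi>: "\<psi> \<in> add_chars" and I: "finite I"
    and \<alpha>: "\<alpha> \<in> mult_chars" and \<beta>: "\<beta> \<in> mult_chars" "\<beta> \<noteq> \<epsilon>"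
    and \<gamma>: "\<And>i. i \<in> I \<Longrightarrow> \<gamma> i \<in> mult_chars" and l: "\<And>i. i \<in> I \<Longrightarrow> l i \<noteq> 0"
  defines "\<chi> \<equiv> char_inv \<alpha> \<star> char_prod I \<gamma>"
  assumes \<chi>: "\<chi> \<noteq> \<epsilon>"
  shows "gauss \<psi> \<beta> * gauss \<psi> (char_inv \<chi>) * (\<Sum>u\<in>I \<rightarrow>\<^sub>E (UNIV - {0}).
      char_inv \<beta> (1 - (\<Sum>i\<in>I. l i / u i)) * (\<Prod>i\<in>I. char_inv (\<gamma> i) (u i)) *
      \<chi> (1 - (\<Sum>i\<in>I. u i))) * (of_nat CARD('k) - 1) ^ card I =
    char_prod I \<gamma> (- 1) * (\<Sum>\<nu>\<in>I \<rightarrow>\<^sub>E mult_chars.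
      gauss \<psi> (\<alpha> \<star> char_prod I \<nu>) * gauss \<psi> (\<beta> \<star> char_prod I \<nu>) *
      (\<Prod>i\<in>I. gauss \<psi> (char_inv (\<nu> i)) * gauss \<psi> (char_inv (\<gamma> i \<star> \<nu> i)) * \<nu> i (l i)))"
proof -
  let ?c = "\<lambda>\<nu>. \<Prod>i\<in>I. gauss \<psi> (char_inv (\<nu> i)) * gauss \<psi> (char_inv (\<gamma> i \<star> \<nu> i)) * \<nu> i (l i)"
  let ?K = "\<lambda>x y. \<Prod>i\<in>I. \<Sum>u\<in>UNIV - {0}. char_inv (\<gamma> i) u * \<psi> (- (x * l i) / u + - y * u)"
  let ?N = "(of_nat CARD('k) - 1 :: qbar) ^ card I"
  have P\<gamma>: "char_prod I \<gamma> \<in> mult_chars" using I \<gamma> by simp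
  then have \<chi>_mult: "\<chi> \<in> mult_chars" using \<alpha> by (simp add: \<chi>_def)
  have gauss_product: "c * (gauss \<psi> a * gauss \<psi> b) =
      (\<Sum>x\<in>UNIV - {0}. \<Sum>y\<in>UNIV - {0}. c * ((\<psi> x * a x) * (\<psi> y * b y)))" for c a b
    unfolding gauss_def minus_mult_minus sum_product unfolding sum_distrib_left by (rule refl)
  have \<alpha>_eq: "char_inv \<chi> y * char_prod I \<gamma> (- y) = char_prod I \<gamma> (- 1) * \<alpha> y" if "y \<noteq> 0" for y
    using that mult_char_mult[OF P\<gamma>, of "- 1" y] mult_char_nonzero[OF P\<gamma> that]
    by (simp add: \<chi>_def char_inv_def char_mult_def)
  have "gauss \<psi> \<beta> * gauss \<psi> (char_inv \<chi>) * (\<Sum>u\<in>I \<rightarrow>\<^sub>E (UNIV - {0}).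
      char_inv \<beta> (1 - (\<Sum>i\<in>I. l i / u i)) * (\<Prod>i\<in>I. char_inv (\<gamma> i) (u i)) *
      \<chi> (1 - (\<Sum>i\<in>I. u i))) * ?N =
    (\<Sum>x\<in>UNIV - {0}. \<Sum>y\<in>UNIV - {0}. \<beta> x * char_inv \<chi> y * \<psi> x * \<psi> y * (?K x y * ?N))"
    unfolding integral_times_gauss[OF \<psi> I \<beta> \<chi>_mult \<chi>]
    by (simp only: sum_distrib_right mult.assoc)
  also have "\<dots> = (\<Sum>x\<in>UNIV - {0}. \<Sum>y\<in>UNIV - {0}. \<Sum>\<nu>\<in>I \<rightarrow>\<^sub>E mult_chars.
      char_prod I \<gamma> (- 1) * ?c \<nu> *
      ((\<psi> x * (\<beta> \<star> char_prod I \<nu>) x) * (\<psi> y * (\<alpha> \<star> char_prod I \<nu>) y)))"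
  proof (intro sum.cong refl)
    fix x y :: 'k assume "x \<in> UNIV - {0}" "y \<in> UNIV - {0}"
    then have nz: "x \<noteq> 0" "y \<noteq> 0" by auto
    have "\<beta> x * char_inv \<chi> y * \<psi> x * \<psi> y * (?K x y * ?N) =
        (char_inv \<chi> y * char_prod I \<gamma> (- y)) * \<beta> x * \<psi> x * \<psi> y *
        (\<Sum>\<nu>\<in>I \<rightarrow>\<^sub>E mult_chars. ?c \<nu> * (char_prod I \<nu> x * char_prod I \<nu> y))"
      by (subst prod_kloosterman[OF \<psi> I \<gamma> l nz]) (simp_all only: mult_ac)
    also have "\<dots> = (\<Sum>\<nu>\<in>I \<rightarrow>\<^sub>E mult_chars. char_prod I \<gamma> (- 1) * ?c \<nu> *
        ((\<psi> x * (\<beta> \<star> char_prod I \<nu>) x) * (\<psi> y * (\<alpha> \<star> char_prod I \<nu>) y)))"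
      unfolding \<alpha>_eq[OF nz(2)] sum_distrib_left by (simp only: char_mult_def mult_ac)
    finally show "\<beta> x * char_inv \<chi> y * \<psi> x * \<psi> y * (?K x y * ?N) = \<dots>" .
  qed
  also have "\<dots> = (\<Sum>\<nu>\<in>I \<rightarrow>\<^sub>E mult_chars. \<Sum>x\<in>UNIV - {0}. \<Sum>y\<in>UNIV - {0}.
      char_prod I \<gamma> (- 1) * ?c \<nu> *
      ((\<psi> x * (\<beta> \<star> char_prod I \<nu>) x) * (\<psi> y * (\<alpha> \<star> char_prod I \<nu>) y)))"
    by (subst (2) sum.swap) (intro sum.cong refl sum.swap)
  also have "\<dots> = (\<Sum>\<nu>\<in>I \<rightarrow>\<^sub>E mult_chars. char_prod I \<gamma> (- 1) * ?c \<nu> *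
      (gauss \<psi> (\<beta> \<star> char_prod I \<nu>) * gauss \<psi> (\<alpha> \<star> char_prod I \<nu>)))"
    by (intro sum.cong refl gauss_product[symmetric])
  finally show ?thesis by (simp only: sum_distrib_left mult_ac)
qed

section \<open>The hypergeometric function as the same character sum\<close>

lemma of_nat_card_neq_1: "(of_nat CARD('k :: finite_field) :: qbar) \<noteq> 1"
proof
  assume "(of_nat CARD('k) :: qbar) = 1"
  then have "card (UNIV :: 'k set) = 1" by (simp only: of_nat_eq_1_iff)
  then show False by (metis card_1_singletonE UNIV_I singletonD zero_neq_one)
qed

text \<open>
  Divided by the two denominators that belong to \<open>\<nu>\<^sub>i\<close>, the factor \<open>g(\<gamma>\<^sub>i\<^sup>-\<^sup>1)\<close> becomes a product of two
  Gauss sums, by \<open>gauss_div_poch_circ\<close>.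
\<close>

lemma lauricella_FC_eq_character_sum:
  fixes \<psi> :: "'k :: finite_field \<Rightarrow> qbar"
  assumes \<psi>: "\<psi> \<in> add_chars" "\<psi> \<noteq> (\<lambda>_. 1)"
    and \<alpha>: "\<alpha> \<in> mult_chars" and \<beta>: "\<beta> \<in> mult_chars"
    and \<gamma>: "\<And>i. i \<in> {1..n} \<Longrightarrow> \<gamma> i \<in> mult_chars"
  shows "(1 - of_nat CARD('k)) ^ n * gauss \<psi> \<alpha> * gauss \<psi> \<beta> *
      (\<Prod>i=1..n. gauss \<psi> (char_inv (\<gamma> i))) * lauricella_FC \<psi> n \<alpha> \<beta> \<gamma> l =
    (\<Sum>\<nu>\<in>{1..n} \<rightarrow>\<^sub>E mult_chars.
      gauss \<psi> (\<alpha> \<star> char_prod {1..n} \<nu>) * gauss \<psi> (\<beta> \<star> char_prod {1..n} \<nu>) *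
      (\<Prod>i=1..n. gauss \<psi> (char_inv (\<nu> i)) * gauss \<psi> (char_inv (\<gamma> i \<star> \<nu> i)) * \<nu> i (l i)))"
proof -
  let ?q = "of_nat CARD('k) :: qbar"
  let ?P = "\<lambda>\<nu>. char_prod {1..n} \<nu>"
  have q: "(1 - ?q) ^ n \<noteq> 0" using of_nat_card_neq_1[where 'k = 'k] by simp
  have cancel: "D * a * b * c * (1 / D * T) = a * b * c * T" if "D \<noteq> 0" for D a b c T :: qbar
    using that by simp
  have term_eq: "gauss \<psi> \<alpha> * gauss \<psi> \<beta> * (\<Prod>i=1..n. gauss \<psi> (char_inv (\<gamma> i))) *
      (poch \<psi> \<alpha> (?P \<nu>) * poch \<psi> \<beta> (?P \<nu>) /
        ((\<Prod>i=1..n. poch_circ \<psi> (\<gamma> i) (\<nu> i)) * (\<Prod>i=1..n. poch_circ \<psi> \<epsilon> (\<nu> i))) *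
        (\<Prod>i=1..n. \<nu> i (l i))) =
    gauss \<psi> (\<alpha> \<star> ?P \<nu>) * gauss \<psi> (\<beta> \<star> ?P \<nu>) *
      (\<Prod>i=1..n. gauss \<psi> (char_inv (\<nu> i)) * gauss \<psi> (char_inv (\<gamma> i \<star> \<nu> i)) * \<nu> i (l i))"
    if "\<nu> \<in> {1..n} \<rightarrow>\<^sub>E mult_chars" for \<nu>
  proof -
    have \<nu>: "\<nu> i \<in> mult_chars" if "i \<in> {1..n}" for i
      using \<open>\<nu> \<in> _\<close> that by auto
    have "(\<Prod>i=1..n. gauss \<psi> (char_inv (\<gamma> i))) /
        ((\<Prod>i=1..n. poch_circ \<psi> (\<gamma> i) (\<nu> i)) * (\<Prod>i=1..n. poch_circ \<psi> \<epsilon> (\<nu> i))) =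
      (\<Prod>i=1..n. gauss \<psi> (char_inv (\<gamma> i)) /
        (poch_circ \<psi> (\<gamma> i) (\<nu> i) * poch_circ \<psi> \<epsilon> (\<nu> i)))"
      by (simp only: prod.distrib prod_dividef)
    also have "\<dots> = (\<Prod>i=1..n. gauss \<psi> (char_inv (\<nu> i)) * gauss \<psi> (char_inv (\<gamma> i \<star> \<nu> i)))"
      using \<gamma> \<nu> by (intro prod.cong refl gauss_div_poch_circ[OF \<psi>])
    finally have "(\<Prod>i=1..n. gauss \<psi> (char_inv (\<nu> i)) * gauss \<psi> (char_inv (\<gamma> i \<star> \<nu> i)) * \<nu> i (l i)) =
        (\<Prod>i=1..n. gauss \<psi> (char_inv (\<gamma> i))) /
        ((\<Prod>i=1..n. poch_circ \<psi> (\<gamma> i) (\<nu> i)) * (\<Prod>i=1..n. poch_circ \<psi> \<epsilon> (\<nu> i))) *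
        (\<Prod>i=1..n. \<nu> i (l i))"
      by (simp only: prod.distrib[of _ "\<lambda>i. \<nu> i (l i)"])
    moreover have "gauss \<psi> (\<alpha> \<star> ?P \<nu>) = gauss \<psi> \<alpha> * poch \<psi> \<alpha> (?P \<nu>)"
      "gauss \<psi> (\<beta> \<star> ?P \<nu>) = gauss \<psi> \<beta> * poch \<psi> \<beta> (?P \<nu>)"
      using gauss_nonzero[OF \<psi> \<alpha>] gauss_nonzero[OF \<psi> \<beta>] by (simp_all add: poch_def)
    ultimately show ?thesis by (simp only: times_divide_eq_left times_divide_eq_right mult_ac)
  qed
  have "(1 - ?q) ^ n * gauss \<psi> \<alpha> * gauss \<psi> \<beta> *
      (\<Prod>i=1..n. gauss \<psi> (char_inv (\<gamma> i))) * lauricella_FC \<psi> n \<alpha> \<beta> \<gamma> l =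
    gauss \<psi> \<alpha> * gauss \<psi> \<beta> * (\<Prod>i=1..n. gauss \<psi> (char_inv (\<gamma> i))) *
    (\<Sum>\<nu>\<in>{1..n} \<rightarrow>\<^sub>E mult_chars. poch \<psi> \<alpha> (?P \<nu>) * poch \<psi> \<beta> (?P \<nu>) /
        ((\<Prod>i=1..n. poch_circ \<psi> (\<gamma> i) (\<nu> i)) * (\<Prod>i=1..n. poch_circ \<psi> \<epsilon> (\<nu> i))) *
        (\<Prod>i=1..n. \<nu> i (l i)))"
    unfolding lauricella_FC_def by (rule cancel[OF q])
  also have "\<dots> = (\<Sum>\<nu>\<in>{1..n} \<rightarrow>\<^sub>E mult_chars.
      gauss \<psi> (\<alpha> \<star> ?P \<nu>) * gauss \<psi> (\<beta> \<star> ?P \<nu>) *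
      (\<Prod>i=1..n. gauss \<psi> (char_inv (\<nu> i)) * gauss \<psi> (char_inv (\<gamma> i \<star> \<nu> i)) * \<nu> i (l i)))"
    unfolding sum_distrib_left by (intro sum.cong refl term_eq)
  finally show ?thesis .
qed

theorem theorem3p7:
  fixes \<psi> :: "'k :: finite_field \<Rightarrow> qbar"
    and n :: nat
    and \<alpha> \<beta> :: "'k \<Rightarrow> qbar"
    and \<gamma> :: "nat \<Rightarrow> 'k \<Rightarrow> qbar"
    and l :: "nat \<Rightarrow> 'k"
  assumes "\<psi> \<in> add_chars" and "\<psi> \<noteq> (\<lambda>_. 1)"
    and "n \<ge> 1"
    and "\<alpha> \<in> mult_chars" and "\<beta> \<in> mult_chars"
    and "\<forall>i\<in>{1..n}. \<gamma> i \<in> mult_chars"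
    and "char_inv \<alpha> \<star> char_prod {1..n} \<gamma> \<noteq> \<epsilon>"
    and "\<beta> \<noteq> \<epsilon>"
    and "\<forall>i\<in>{1..n}. l i \<noteq> 0"
  shows "(-1) ^ n *
      ((\<Prod>i=1..n. gauss \<psi> (char_inv (\<gamma> i))) * gauss \<psi> (char_inv \<alpha> \<star> char_prod {1..n} \<gamma>) /
        gauss_circ \<psi> (char_inv \<alpha>)) *
      lauricella_FC \<psi> n \<alpha> \<beta> \<gamma> l =
    (\<Sum>u\<in>{1..n} \<rightarrow>\<^sub>E (UNIV - {0}).
      char_inv \<beta> (1 - (\<Sum>i=1..n. l i / u i)) *
      (\<Prod>i=1..n. char_inv (\<gamma> i) (u i)) *
      (char_inv \<alpha> \<star> char_prod {1..n} \<gamma>) (1 - (\<Sum>i=1..n. u i)))"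
proof -
  let ?q = "of_nat CARD('k) :: qbar"
  let ?F = "lauricella_FC \<psi> n \<alpha> \<beta> \<gamma> l"
  let ?G = "\<Prod>i=1..n. gauss \<psi> (char_inv (\<gamma> i))"
  let ?P = "char_prod {1..n} \<gamma>"
  define \<chi> where "\<chi> = char_inv \<alpha> \<star> ?P"
  define S where "S = (\<Sum>u\<in>{1..n} \<rightarrow>\<^sub>E (UNIV - {0}).
      char_inv \<beta> (1 - (\<Sum>i=1..n. l i / u i)) * (\<Prod>i=1..n. char_inv (\<gamma> i) (u i)) *
      \<chi> (1 - (\<Sum>i=1..n. u i)))"
  note \<psi> = assms(1,2)
  have \<gamma>: "\<gamma> i \<in> mult_chars" and l: "l i \<noteq> 0" if "i \<in> {1..n}" for i
    using assms that by auto
  have "?P \<in> mult_chars" using \<gamma> by (rule char_prod_in_mult_chars[OF finite_atLeastAtMost])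
  then have \<chi>: "\<chi> \<in> mult_chars" "\<chi> \<noteq> \<epsilon>" using assms unfolding \<chi>_def by auto
  have "?q \<noteq> 1" by (rule of_nat_card_neq_1)
  have "gauss \<psi> \<beta> * gauss \<psi> (char_inv \<chi>) * S * (?q - 1) ^ n =
      ?P (- 1) * ((1 - ?q) ^ n * gauss \<psi> \<alpha> * gauss \<psi> \<beta> * ?G * ?F)"
    using integral_eq_character_sum[OF \<psi>(1) finite_atLeastAtMost assms(4,5,8) \<gamma> l assms(7)]
      lauricella_FC_eq_character_sum[OF \<psi> assms(4,5) \<gamma>, where l = l]
    by (simp add: S_def \<chi>_def)
  also have "(1 - ?q) ^ n = (- 1) ^ n * (?q - 1) ^ n"
    by (simp flip: power_mult_distrib)
  finally have "(gauss \<psi> \<beta> * (?q - 1) ^ n) * (gauss \<psi> (char_inv \<chi>) * S) =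
      (gauss \<psi> \<beta> * (?q - 1) ^ n) * ((- 1) ^ n * (?P (- 1) * gauss \<psi> \<alpha>) * ?G * ?F)"
    by (simp only: mult_ac)
  then have S: "gauss \<psi> (char_inv \<chi>) * S = (- 1) ^ n * (?P (- 1) * gauss \<psi> \<alpha>) * ?G * ?F"
    using \<open>?q \<noteq> 1\<close> gauss_nonzero[OF \<psi> assms(5)] by simp
  have circ: "gauss_circ \<psi> (char_inv \<alpha>) \<noteq> 0"
    using gauss_circ_nonzero[OF \<psi>] assms(4) by simp
  \<comment> \<open>Reflection for \<open>\<chi>\<close> and for \<open>\<alpha>\<^sup>-\<^sup>1\<close>, together with \<open>\<chi>(-1) = \<alpha>\<^sup>-\<^sup>1(-1) \<gamma>\<^sub>1\<cdots>\<gamma>\<^sub>n(-1)\<close>, identifies the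
    remaining constants.\<close>
  have "gauss \<psi> (char_inv \<chi>) * gauss \<psi> \<chi> = ?P (- 1) * (char_inv \<alpha> (- 1) * ?q)"
    using gauss_reflection[OF \<psi> \<chi>(1)] \<chi>(2)
    by (simp add: gauss_circ_def char_delta_def \<chi>_def char_mult_def mult_ac)
  also have "\<dots> = ?P (- 1) * gauss \<psi> \<alpha> * gauss_circ \<psi> (char_inv \<alpha>)"
    using gauss_reflection[OF \<psi>, of "char_inv \<alpha>"] assms(4) by simp
  finally have "?P (- 1) * gauss \<psi> \<alpha> =
      gauss \<psi> (char_inv \<chi>) * gauss \<psi> \<chi> / gauss_circ \<psi> (char_inv \<alpha>)"
    using circ by (simp add: divide_simps)
  then have "gauss \<psi> (char_inv \<chi>) * S = gauss \<psi> (char_inv \<chi>) *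
      ((- 1) ^ n * (?G * gauss \<psi> \<chi> / gauss_circ \<psi> (char_inv \<alpha>)) * ?F)"
    using S by (simp only: times_divide_eq_left times_divide_eq_right mult_ac)
  then have "S = (- 1) ^ n * (?G * gauss \<psi> \<chi> / gauss_circ \<psi> (char_inv \<alpha>)) * ?F"
    using gauss_nonzero[OF \<psi>, of "char_inv \<chi>"] \<chi>(1)
    by (simp only: mult_left_cancel char_inv_in_mult_chars not_False_eq_True)
  then show ?thesis unfolding S_def \<chi>_def by (rule sym)
qed

end
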